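(* Let $n\ge4$ and let $CSL$ be the inductive strategy of length $n$ with $CSL[n]=[n,1,2,\dots,n-1]$. Then the number of permutations $\pi\in S_n$ such that the game with strategy $CSL$ and secret $\pi$ ends after exactly three guesses and $\rho_{CSL}(\pi)=2$ equals $L_n-n-1$, where $L_n$ is the $n$-th Lucas number.
   Context: Permutation wordle on $[n]=\{1,\dots,n\}$: a secret permutation $\pi\in S_n$ (one-line notation) is fixed. The first guess is $\gamma_1=[1,2,\dots,n]$. After guess $\gamma_r$ the guesser learns $\mathcal{J}_r=\{i:\gamma_r(i)=\pi(i)\}$; $\mathcal{I}_r=[n]\setminus\mathcal{J}_r$. The game ends at the first $r$ with $\mathcal{J}_r=[n]$. A strategy of length $n$ is a sequence $S=(S[1],\dots,S[n])$ with $S[k]$ a permutation of $[k]$; if $\mathcal{I}_r=\{i_1<\dots<i_k\}\neq\emptyset$ and $\sigma=S[k]$, then $\gamma_{r+1}(i)=\gamma_r(i)$ for $i\in\mathcal{J}_r$ and $\gamma_{r+1}(i_{\sigma(j)})=\gamma_r(i_j)$ for $j=1,\dots,k$. The cyclic shift strategy $CS$ has $CS[k]=[2,3,\dots,k,1]$; the strategy $CSL$ of length $n$ has $CSL[k]=CS[k]$ for $k\le n-1$ and $CSL[n]=[n,1,2,\dots,n-1]$. For a secret $\pi$, $\rho_S(\pi)=\min\{i:\mathcal{J}_i\neq\emptyset\}$. Lucas numbers: $L_0=2$, $L_1=1$, $L_m=L_{m-1}+L_{m-2}$. *)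

theory Defs
  imports "HOL-Combinatorics.Permutations"
begin

text \<open>
  Permutations of \<open>{1..n}\<close> are functions on \<open>nat\<close> that satisfy \<open>permutes {1..n}\<close>; they are the
  identity outside \<open>{1..n}\<close>, so that distinct functions are distinct permutations. The value
  \<open>p i\<close> is the \<open>i\<close>-th entry of the one-line notation of \<open>p\<close>.
\<close>

type_synonym strategy = "nat \<Rightarrow> nat \<Rightarrow> nat"

definition is_strategy :: "nat \<Rightarrow> strategy \<Rightarrow> bool" where
  "is_strategy n S \<longleftrightarrow> (\<forall>k\<in>{1..n}. S k permutes {1..k})"

definition correct_positions :: "nat \<Rightarrow> (nat \<Rightarrow> nat) \<Rightarrow> (nat \<Rightarrow> nat) \<Rightarrow> nat set" where
  "correct_positions n \<pi> g = {i \<in> {1..n}. g i = \<pi> i}"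

text \<open>The \<open>j\<close>-th smallest element of a finite set, counted from 1.\<close>

definition nth_smallest :: "nat set \<Rightarrow> nat \<Rightarrow> nat" where
  "nth_smallest I j = sorted_list_of_set I ! (j - 1)"

text \<open>
  With \<open>I = {i\<^sub>1 < \<dots> < i\<^sub>k}\<close> the incorrect positions of the guess \<open>g\<close> and \<open>\<sigma> = S k\<close>, the next
  guess moves the entry at \<open>i\<^sub>j\<close> to the position with index \<open>\<sigma> j\<close>. To give the new entry at a
  position \<open>i\<close> in \<open>I\<close>, the definition looks up the unique \<open>j\<close> whose target position is \<open>i\<close>.
  Lemmas \<open>next_guess_correct\<close> and \<open>next_guess_incorrect\<close> below give the rule in its usual form.
\<close>

definition next_guess :: "nat \<Rightarrow> strategy \<Rightarrow> (nat \<Rightarrow> nat) \<Rightarrow> (nat \<Rightarrow> nat) \<Rightarrow> nat \<Rightarrow> nat" where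
  "next_guess n S \<pi> g =
    (let I = {1..n} - correct_positions n \<pi> g; \<sigma> = S (card I) in
      (\<lambda>i. if i \<in> I
           then g (nth_smallest I (THE j. j \<in> {1..card I} \<and> nth_smallest I (\<sigma> j) = i))
           else g i))"

text \<open>
  Guesses are numbered from 1. Once the secret has been guessed, the sequence stays constant.
\<close>

definition guess :: "nat \<Rightarrow> strategy \<Rightarrow> (nat \<Rightarrow> nat) \<Rightarrow> nat \<Rightarrow> nat \<Rightarrow> nat" where
  "guess n S \<pi> r = (next_guess n S \<pi> ^^ (r - 1)) id"

definition correct_at :: "nat \<Rightarrow> strategy \<Rightarrow> (nat \<Rightarrow> nat) \<Rightarrow> nat \<Rightarrow> nat set" where
  "correct_at n S \<pi> r = correct_positions n \<pi> (guess n S \<pi> r)"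

definition game_ends_after :: "nat \<Rightarrow> strategy \<Rightarrow> (nat \<Rightarrow> nat) \<Rightarrow> nat \<Rightarrow> bool" where
  "game_ends_after n S \<pi> m \<longleftrightarrow>
    1 \<le> m \<and> correct_at n S \<pi> m = {1..n} \<and> (\<forall>r. 1 \<le> r \<and> r < m \<longrightarrow> correct_at n S \<pi> r \<noteq> {1..n})"

text \<open>
  This is specified only if some guess has a correct position, which holds in every game that ends
  (for \<open>n \<ge> 1\<close>).
\<close>

definition rho :: "nat \<Rightarrow> strategy \<Rightarrow> (nat \<Rightarrow> nat) \<Rightarrow> nat" where
  "rho n S \<pi> = (LEAST r. 1 \<le> r \<and> correct_at n S \<pi> r \<noteq> {})"

definition CS :: strategy where
  "CS k j = (if j \<in> {1..k} then if j < k then j + 1 else 1 else j)"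

definition CSL :: "nat \<Rightarrow> strategy" where
  "CSL n k = (if k = n then (\<lambda>j. if j \<in> {1..n} then if j = 1 then n else j - 1 else j) else CS k)"

fun lucas :: "nat \<Rightarrow> nat" where
  "lucas 0 = 2"
| "lucas (Suc 0) = 1"
| "lucas (Suc (Suc m)) = lucas (Suc m) + lucas m"


lemma CS_permutes: "CS k permutes {1..k}"
proof (rule bij_imp_permutes)
  show "bij_betw (CS k) {1..k} {1..k}"
    by (rule bij_betw_byWitness[where f' = "\<lambda>j. if j = 1 then k else j - 1"]) (auto simp: CS_def)
qed (auto simp: CS_def)

lemma CSL_permutes: "CSL n k permutes {1..k}"
proof (cases "k = n")
  case True
  have "bij_betw (CSL n n) {1..n} {1..n}"
    by (rule bij_betw_byWitness[where f' = "\<lambda>j. if j = n then 1 else j + 1"]) (auto simp: CSL_def)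
  then have "CSL n n permutes {1..n}"
    by (rule bij_imp_permutes) (auto simp: CSL_def)
  with True show ?thesis by simp
next
  case False
  then show ?thesis using CS_permutes[of k] by (simp add: CSL_def)
qed

lemma is_strategy_CS: "is_strategy n CS"
  using CS_permutes by (simp add: is_strategy_def del: One_nat_def)

lemma is_strategy_CSL: "is_strategy n (CSL n)"
  using CSL_permutes by (simp add: is_strategy_def del: One_nat_def)

lemma bij_betw_nth_smallest:
  assumes "finite I"
  shows "bij_betw (nth_smallest I) {1..card I} I"
proof -
  have "bij_betw (\<lambda>j. j - 1) {1..card I} {..<card I}"
    by (rule bij_betw_byWitness[where f' = Suc]) auto
  moreover have "bij_betw ((!) (sorted_list_of_set I)) {..<card I} I"
    using assms by (intro bij_betw_nth) auto
  ultimately have "bij_betw ((!) (sorted_list_of_set I) \<circ> (\<lambda>j. j - 1)) {1..card I} I"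
    by (rule bij_betw_trans)
  then show ?thesis by (simp add: nth_smallest_def[abs_def] comp_def)
qed

lemma next_guess_correct:
  "i \<in> correct_positions n \<pi> g \<Longrightarrow> next_guess n S \<pi> g i = g i"
  by (simp add: next_guess_def Let_def)

lemma next_guess_incorrect:
  assumes "is_strategy n S"
    and "I = {1..n} - correct_positions n \<pi> g" and "j \<in> {1..card I}"
  shows "next_guess n S \<pi> g (nth_smallest I (S (card I) j)) = g (nth_smallest I j)"
proof -
  let ?\<sigma> = "S (card I)"
  have fin: "finite I" using assms(2) by simp
  have "card I \<le> n"
    using card_mono[of "{1..n}" I] assms(2) by auto
  then have "?\<sigma> permutes {1..card I}"
    using assms(1,3) by (simp add: is_strategy_def)
  then have "bij_betw ?\<sigma> {1..card I} {1..card I}"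
    by (rule permutes_imp_bij)
  then have bij: "bij_betw (nth_smallest I \<circ> ?\<sigma>) {1..card I} I"
    using bij_betw_nth_smallest[OF fin] by (rule bij_betw_trans)
  then have "nth_smallest I (?\<sigma> j) \<in> I"
    using assms(3) by (auto dest!: bij_betwE)
  moreover have "(THE j'. j' \<in> {1..card I} \<and> nth_smallest I (?\<sigma> j') = nth_smallest I (?\<sigma> j)) = j"
  proof (rule the_equality)
    fix j' assume j': "j' \<in> {1..card I} \<and> nth_smallest I (?\<sigma> j') = nth_smallest I (?\<sigma> j)"
    show "j' = j"
      by (rule inj_onD[OF bij_betw_imp_inj_on[OF bij]]) (use j' assms(3) in \<open>simp_all add: comp_def\<close>)
  qed (use assms(3) in simp)
  ultimately show ?thesis
    unfolding next_guess_def Let_def assms(2)[symmetric] by simp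
qed

end

theory Submission
  imports Defs "HOL-Number_Theory.Fib"
begin

text \<open>
  For a derangement \<open>\<pi>\<close> the second guess is the cycle \<open>i \<mapsto> i + 1\<close> modulo \<open>n\<close>, so the whole game is
  determined by the set \<open>I\<close> of positions that are wrong in it. The third guess sends \<open>i \<in> I\<close> to
  \<open>p + 1\<close>, where \<open>p\<close> is the cyclic predecessor of \<open>i\<close> inside \<open>I\<close>. If this guess is \<open>\<pi>\<close>, then \<open>\<pi>\<close> has
  no fixed point exactly when \<open>I\<close> contains no two cyclically adjacent elements, and \<open>I\<close> really is the
  set of wrong positions exactly when it does not have just one element. So the secrets correspond to the
  independent sets of size at least 2 of the cycle graph on \<open>n\<close> vertices, which has \<open>L\<^sub>n\<close>
  independent sets, including the empty one and \<open>n\<close> singletons.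
\<close>

section \<open>Independent sets of paths and cycles\<close>

text \<open>\<open>m\<close> counts vertices. The start \<open>a\<close> is free because cutting the
  cycle leaves paths that begin at 1 and at 2.\<close>

definition path_indep :: "nat \<Rightarrow> nat \<Rightarrow> nat set set" where
  "path_indep a m = {I. \<forall>i\<in>I. a \<le> i \<and> i < a + m \<and> Suc i \<notin> I}"

definition cycle_indep :: "nat \<Rightarrow> nat set set" where
  "cycle_indep n = {I. I \<subseteq> {1..n} \<and> (\<forall>i\<in>I. CS n i \<notin> I)}"

lemma finite_path_indep: "finite (path_indep a m)"
  by (rule finite_subset[of _ "Pow {a..<a + m}"]) (auto simp: path_indep_def)

lemma finite_cycle_indep: "finite (cycle_indep n)"
  by (rule finite_subset[of _ "Pow {1..n}"]) (auto simp: cycle_indep_def)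

text \<open>Split on the last vertex \<open>Suc (a + m)\<close>: a set containing it must omit its
  neighbour \<open>a + m\<close>, so the rest lives on the first \<open>m\<close> vertices.\<close>

lemma path_indep_Suc_Suc:
  "path_indep a (Suc (Suc m)) = path_indep a (Suc m) \<union> insert (Suc (a + m)) ` path_indep a m"
  (is "?L = ?A \<union> ?B")
proof
  show "?L \<subseteq> ?A \<union> ?B"
  proof
    fix I assume I: "I \<in> ?L"
    then have bnd: "a \<le> x \<and> x < Suc (Suc (a + m)) \<and> Suc x \<notin> I" if "x \<in> I" for x
      using that by (simp add: path_indep_def)
    show "I \<in> ?A \<union> ?B"
    proof (cases "Suc (a + m) \<in> I")
      case True
      then have "a + m \<notin> I"
        using bnd by blast
      then have "x < a + m" if "x \<in> I" "x \<noteq> Suc (a + m)" for x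
        using bnd[OF that(1)] that by (cases "x = a + m") auto
      with bnd have "I - {Suc (a + m)} \<in> path_indep a m"
        by (simp add: path_indep_def)
      moreover have "I = insert (Suc (a + m)) (I - {Suc (a + m)})"
        using True by blast
      ultimately show ?thesis by blast
    next
      case False
      then have "x < Suc (a + m)" if "x \<in> I" for x
        using bnd[OF that] that by (cases "x = Suc (a + m)") auto
      with bnd have "I \<in> ?A"
        by (simp add: path_indep_def)
      then show ?thesis by blast
    qed
  qed
  show "?A \<union> ?B \<subseteq> ?L"
  proof (rule Un_least)
    show "?A \<subseteq> ?L"
      by (auto simp: path_indep_def less_Suc_eq)
    show "?B \<subseteq> ?L"
    proof (rule image_subsetI)
      fix I assume "I \<in> path_indep a m"
      then have "a \<le> x \<and> x < a + m \<and> Suc x \<notin> I" if "x \<in> I" for x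
        using that by (simp add: path_indep_def)
      then show "insert (Suc (a + m)) I \<in> ?L"
        by (fastforce simp: path_indep_def)
    qed
  qed
qed

text \<open>The split on the last vertex is the Fibonacci recurrence. The counts 1 and 2 for zero
  and one vertex are \<open>fib 2\<close> and \<open>fib 3\<close>, hence the shift by 2.\<close>

lemma card_path_indep: "card (path_indep a m) = fib (m + 2)"
proof (induction m rule: fib.induct)
  case 1
  have "path_indep a 0 = {{}}" by (auto simp: path_indep_def)
  then show ?case by simp
next
  case 2
  have "a \<le> i \<and> i < a + Suc 0 \<longleftrightarrow> i = a" for i by auto
  then have "path_indep a (Suc 0) = {I. \<forall>i\<in>I. i = a \<and> Suc i \<notin> I}"
    by (simp add: path_indep_def flip: conj_assoc)
  also have "\<dots> = Pow {a}" by (auto; metis n_not_Suc_n singletonD subsetD)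
  finally show ?case by (simp add: card_Pow numeral_eq_Suc)
next
  case (3 m)
  have "inj_on (insert (Suc (a + m))) (path_indep a m)"
    by (rule inj_on_inverseI[where g = "\<lambda>I. I - {Suc (a + m)}"]) (auto simp: path_indep_def)
  moreover have "path_indep a (Suc m) \<inter> insert (Suc (a + m)) ` path_indep a m = {}"
    by (auto simp: path_indep_def)
  ultimately have "card (path_indep a (Suc (Suc m))) = card (path_indep a (Suc m)) + card (path_indep a m)"
    unfolding path_indep_Suc_Suc by (simp add: card_Un_disjoint finite_path_indep card_image)
  with 3 show ?case by simp
qed

text \<open>Split on vertex \<open>m + 3\<close>. Without it the cycle opens to the path from 1 to
  \<open>m + 2\<close>; with it both neighbours, \<open>m + 2\<close> and 1, are excluded, which
  leaves the \<open>m\<close> vertices from 2 to \<open>m + 1\<close>.\<close>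

lemma cycle_indep_eq:
  "cycle_indep (m + 3) = path_indep 1 (m + 2) \<union> insert (m + 3) ` path_indep 2 m"
  (is "?L = ?A \<union> ?B")
proof
  show "?L \<subseteq> ?A \<union> ?B"
  proof
    fix I assume I: "I \<in> ?L"
    then have sub: "I \<subseteq> {1..m + 3}" and nadj: "\<And>i. i \<in> I \<Longrightarrow> CS (m + 3) i \<notin> I"
      by (auto simp: cycle_indep_def)
    \<comment> \<open>The cyclic condition implies the linear one; only the wrap-around from
      \<open>m + 3\<close> to 1 says more.\<close>
    have suc: "Suc i \<notin> I" if "i \<in> I" for i
    proof (cases "i < m + 3")
      case True
      then show ?thesis using nadj[OF that] sub that by (auto simp: CS_def split: if_splits)
    next
      case False
      then show ?thesis using sub by auto
    qed
    show "I \<in> ?A \<union> ?B"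
    proof (cases "m + 3 \<in> I")
      case True
      have "1 \<notin> I"
        using nadj[OF True] by (simp add: CS_def)
      have "m + 2 \<notin> I"
        using suc[of "m + 2"] True by (auto simp: eval_nat_numeral)
      have "2 \<le> x \<and> x < m + 2" if "x \<in> I" "x \<noteq> m + 3" for x
      proof -
        have "1 \<le> x" "x \<le> m + 3" "x \<noteq> 1" "x \<noteq> m + 2"
          using sub that \<open>1 \<notin> I\<close> \<open>m + 2 \<notin> I\<close> by auto
        with that show ?thesis by linarith
      qed
      with suc have "I - {m + 3} \<in> path_indep 2 m"
        by (simp add: path_indep_def)
      moreover have "I = insert (m + 3) (I - {m + 3})"
        using True by blast
      ultimately show ?thesis by blast
    next
      case False
      have "1 \<le> x \<and> x < 1 + (m + 2)" if "x \<in> I" for x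
      proof -
        have "1 \<le> x" "x \<le> m + 3" "x \<noteq> m + 3" using sub that False by auto
        then show ?thesis by linarith
      qed
      with suc have "I \<in> ?A"
        unfolding path_indep_def by blast
      then show ?thesis by blast
    qed
  qed
  show "?A \<union> ?B \<subseteq> ?L"
  proof (rule Un_least; rule subsetI)
    fix I assume "I \<in> ?A"
    then have bnd: "1 \<le> x \<and> x < m + 3 \<and> Suc x \<notin> I" if "x \<in> I" for x
      using that by (simp add: path_indep_def eval_nat_numeral)
    then have "CS (m + 3) x \<notin> I" if "x \<in> I" for x
      using bnd[OF that] by (simp add: CS_def)
    with bnd show "I \<in> ?L"
      by (auto simp: cycle_indep_def less_imp_le)
  next
    fix J assume "J \<in> ?B"
    then obtain I where J: "J = insert (m + 3) I" and I: "I \<in> path_indep 2 m" by blast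
    have bnd: "2 \<le> x \<and> x < m + 2 \<and> Suc x \<notin> I" if "x \<in> I" for x
      using I that by (simp add: path_indep_def)
    have "CS (m + 3) x \<notin> J" if x: "x \<in> J" for x
    proof (cases "x = m + 3")
      case True
      have "1 \<notin> I" using bnd[of 1] by auto
      then show ?thesis by (simp add: True CS_def J)
    next
      case False
      then show ?thesis using bnd[of x] x by (simp add: CS_def J)
    qed
    moreover have "J \<subseteq> {1..m + 3}"
      using bnd by (fastforce simp: J)
    ultimately show "J \<in> ?L"
      by (simp add: cycle_indep_def)
  qed
qed

lemma lucas_eq_fib: "lucas (Suc m) = fib (m + 2) + fib m"
  by (induction m rule: fib.induct) (simp_all add: numeral_eq_Suc)

lemma card_cycle_indep:
  assumes "n \<ge> 3"
  shows "card (cycle_indep n) = lucas n"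
proof -
  obtain m where n: "n = m + 3"
    using assms by (metis le_add_diff_inverse2)
  have "inj_on (insert (m + 3)) (path_indep 2 m)"
    by (rule inj_on_inverseI[where g = "\<lambda>I. I - {m + 3}"]) (auto simp: path_indep_def)
  moreover have "path_indep 1 (m + 2) \<inter> insert (m + 3) ` path_indep 2 m = {}"
    by (auto simp: path_indep_def)
  ultimately have "card (cycle_indep n) = card (path_indep 1 (m + 2)) + card (path_indep 2 m)"
    unfolding n cycle_indep_eq
    by (simp add: card_Un_disjoint finite_path_indep card_image del: One_nat_def)
  also have "\<dots> = fib (m + 4) + fib (m + 2)"
    by (simp only: card_path_indep) (simp add: numeral_eq_Suc)
  also have "\<dots> = lucas n"
    using lucas_eq_fib[of "m + 2"] by (simp add: n numeral_eq_Suc)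
  finally show ?thesis .
qed

lemma CS_neq_self: "2 \<le> n \<Longrightarrow> i \<in> {1..n} \<Longrightarrow> CS n i \<noteq> i"
  by (auto simp: CS_def)

lemma CS_in_range: "i \<in> {1..n} \<Longrightarrow> CS n i \<in> {1..n}"
  by (auto simp: CS_def)

lemma inj_CS: "inj (CS n)"
  using CS_permutes by (rule permutes_inj)

text \<open>The sets left out are the empty set and the \<open>n\<close> singletons, which are
  independent because \<open>CS n\<close> has no fixed point on \<open>{1..n}\<close>.\<close>

lemma card_cycle_indep_ge_2:
  assumes "n \<ge> 3"
  shows "card {I \<in> cycle_indep n. 2 \<le> card I} + n + 1 = lucas n"
proof -
  let ?A = "{I \<in> cycle_indep n. 2 \<le> card I}" and ?S = "(\<lambda>i. {i}) ` {1..n}"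
  have "cycle_indep n = insert {} (?A \<union> ?S)"
  proof
    show "cycle_indep n \<subseteq> insert {} (?A \<union> ?S)"
    proof
      fix I assume I: "I \<in> cycle_indep n"
      then have "finite I"
        by (auto simp: cycle_indep_def intro: finite_subset)
      have "card I = 0 \<or> card I = 1 \<or> 2 \<le> card I" by linarith
      with I \<open>finite I\<close> show "I \<in> insert {} (?A \<union> ?S)"
        by (auto simp: card_1_singleton_iff cycle_indep_def)
    qed
    show "insert {} (?A \<union> ?S) \<subseteq> cycle_indep n"
      using CS_neq_self[of n] assms by (auto simp: cycle_indep_def)
  qed
  moreover have "finite (?A \<union> ?S)" "{} \<notin> ?A \<union> ?S"
    using finite_cycle_indep[of n] by auto
  ultimately have "card (cycle_indep n) = Suc (card (?A \<union> ?S))"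
    by (metis card_insert_disjoint)
  also have "card (?A \<union> ?S) = card ?A + card ?S"
    by (rule card_Un_disjoint) (use finite_cycle_indep[of n] in auto)
  also have "card ?S = n"
    by (simp add: card_image)
  finally have "card (cycle_indep n) = Suc (card ?A + n)" .
  then show ?thesis
    using card_cycle_indep[OF assms] by simp
qed

section \<open>Cyclic predecessors within a finite set\<close>

text \<open>When the entries on \<open>I\<close> move by \<open>CS\<close>, the entry arriving at
  \<open>i\<close> comes from \<open>cyclic_pred I i\<close>; the inverse plays the part of the
  \<open>THE\<close> in \<open>next_guess\<close>. Values outside \<open>I\<close> carry no
  meaning.\<close>

definition cyclic_pred :: "nat set \<Rightarrow> nat \<Rightarrow> nat" where
  "cyclic_pred I = nth_smallest I \<circ> inv_into {1..card I} (nth_smallest I \<circ> CS (card I))"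

lemma bij_betw_nth_smallest_CS:
  assumes "finite I"
  shows "bij_betw (nth_smallest I \<circ> CS (card I)) {1..card I} I"
  using permutes_imp_bij[OF CS_permutes] bij_betw_nth_smallest[OF assms] by (rule bij_betw_trans)

lemma nth_smallest_CS_cases:
  assumes "finite I" "i \<in> I"
  obtains j where "j \<in> {1..card I}" "i = nth_smallest I (CS (card I) j)"
  using bij_betw_imp_surj_on[OF bij_betw_nth_smallest_CS[OF assms(1)]] assms(2)
  unfolding comp_def by blast

lemma bij_betw_cyclic_pred: "finite I \<Longrightarrow> bij_betw (cyclic_pred I) I I"
  unfolding cyclic_pred_def
  by (rule bij_betw_trans[OF bij_betw_inv_into[OF bij_betw_nth_smallest_CS] bij_betw_nth_smallest])

lemma cyclic_pred_in: "finite I \<Longrightarrow> i \<in> I \<Longrightarrow> cyclic_pred I i \<in> I"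
  using bij_betw_cyclic_pred bij_betwE by blast

lemma cyclic_pred_nth_smallest:
  assumes "finite I" "j \<in> {1..card I}"
  shows "cyclic_pred I (nth_smallest I (CS (card I) j)) = nth_smallest I j"
  using inv_into_f_f[OF bij_betw_imp_inj_on[OF bij_betw_nth_smallest_CS[OF assms(1)]] assms(2)]
  by (simp add: cyclic_pred_def)

lemma cyclic_pred_neq_self:
  assumes "finite I" "2 \<le> card I" "i \<in> I"
  shows "cyclic_pred I i \<noteq> i"
proof -
  obtain j where j: "j \<in> {1..card I}" "i = nth_smallest I (CS (card I) j)"
    using nth_smallest_CS_cases[OF assms(1,3)] .
  have "CS (card I) j \<noteq> j" "CS (card I) j \<in> {1..card I}"
    using CS_neq_self[OF assms(2) j(1)] CS_in_range[OF j(1)] by auto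
  then show ?thesis
    using cyclic_pred_nth_smallest[OF assms(1) j(1)] j
      inj_onD[OF bij_betw_imp_inj_on[OF bij_betw_nth_smallest[OF assms(1)]]] by metis
qed

lemma strict_mono_on_nth_smallest: "strict_mono_on {1..card I} (nth_smallest I)"
  by (rule strict_mono_onI)
    (auto simp: nth_smallest_def intro!: sorted_wrt_nth_less[OF strict_sorted_list_of_set])

lemma nth_smallest_less_iff:
  assumes "j \<in> {1..card I}" "k \<in> {1..card I}"
  shows "nth_smallest I j < nth_smallest I k \<longleftrightarrow> j < k"
  using strict_mono_on_less[OF strict_mono_on_nth_smallest assms] .

text \<open>Nothing lies cyclically between \<open>i\<close> and \<open>CS n i\<close>, so if both
  belong to \<open>I\<close> they are also consecutive within \<open>I\<close>. Such pairs are what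
  creates fixed points of the secret.\<close>

lemma cyclic_pred_CS:
  assumes "I \<subseteq> {1..n}" "i \<in> I" "CS n i \<in> I"
  shows "cyclic_pred I (CS n i) = i"
proof -
  let ?k = "card I" and ?f = "nth_smallest I"
  have fin: "finite I" using assms(1) finite_subset by blast
  have surj: "\<exists>j\<in>{1..?k}. x = ?f j" if "x \<in> I" for x
    using bij_betw_imp_surj_on[OF bij_betw_nth_smallest[OF fin]] that by (auto simp: image_iff)
  have mem: "?f j \<in> I" if "j \<in> {1..?k}" for j
    using bij_betw_nth_smallest[OF fin] that bij_betwE by blast
  obtain j where j: "j \<in> {1..?k}" "i = ?f j" using surj assms(2) by blast
  obtain l where l: "l \<in> {1..?k}" "CS n i = ?f l" using surj assms(3) by blast
  have "l = CS ?k j"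
  \<comment> \<open>At the wrap-around, \<open>i\<close> is the largest element of \<open>I\<close>
    and \<open>CS n i = 1\<close> the smallest, so their indices are \<open>card I\<close> and 1.
    Otherwise an index strictly between \<open>j\<close> and \<open>l\<close> would give an integer
    strictly between two consecutive ones.\<close>
  proof (cases "i = n")
    case True
    have "l \<le> 1"
    proof -
      have "1 \<in> {1..?k}" using l by auto
      moreover have "\<not> ?f 1 < ?f l"
        using l(2) True assms(1,2) mem[OF \<open>1 \<in> {1..?k}\<close>] by (auto simp: CS_def split: if_splits)
      ultimately show ?thesis using nth_smallest_less_iff[of 1 I l] l(1) by auto
    qed
    moreover have "?k \<le> j"
    proof -
      have "?k \<in> {1..?k}" using l by auto
      moreover have "?f ?k \<le> ?f j"
        using mem[OF \<open>?k \<in> {1..?k}\<close>] assms(1) True j(2) by auto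
      ultimately show ?thesis using nth_smallest_less_iff[of j I ?k] j(1) by auto
    qed
    ultimately show ?thesis using j(1) l(1) by (auto simp: CS_def)
  next
    case False
    then have fl: "?f l = Suc (?f j)"
      using assms(1,2) l(2) j(2) by (auto simp: CS_def split: if_splits)
    then have "j < l" using nth_smallest_less_iff[OF j(1) l(1)] by simp
    moreover have "\<not> Suc j < l"
    proof
      assume "Suc j < l"
      then have "Suc j \<in> {1..?k}" using l(1) by auto
      then have "?f j < ?f (Suc j)" "?f (Suc j) < ?f l"
        using nth_smallest_less_iff j(1) l(1) \<open>Suc j < l\<close> by auto
      then show False using fl by simp
    qed
    ultimately show ?thesis using j(1) l(1) by (auto simp: CS_def)
  qed
  then show ?thesis using cyclic_pred_nth_smallest[OF fin j(1)] j l by simp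
qed

section \<open>The first three guesses\<close>

lemma guess_1: "guess n S \<pi> (Suc 0) = id"
  by (simp add: guess_def)

lemma guess_Suc: "1 \<le> r \<Longrightarrow> guess n S \<pi> (Suc r) = next_guess n S \<pi> (guess n S \<pi> r)"
  by (cases r) (simp_all add: guess_def)

text \<open>The bound \<open>card I < n\<close> keeps the move away from the exceptional permutation
  \<open>CSL n n\<close>.\<close>

lemma next_guess_CS:
  assumes "I = {1..n} - correct_positions n \<pi> g" and "card I < n"
  shows "next_guess n (CSL n) \<pi> g = (\<lambda>i. if i \<in> I then g (cyclic_pred I i) else g i)"
proof
  fix i
  have fin: "finite I" using assms(1) by simp
  have S: "CSL n (card I) = CS (card I)" using assms(2) by (simp add: CSL_def)
  show "next_guess n (CSL n) \<pi> g i = (if i \<in> I then g (cyclic_pred I i) else g i)"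
  proof (cases "i \<in> I")
    case True
    obtain j where j: "j \<in> {1..card I}" "i = nth_smallest I (CS (card I) j)"
      using nth_smallest_CS_cases[OF fin True] .
    then show ?thesis
      using next_guess_incorrect[OF is_strategy_CSL assms(1) j(1)] True
        cyclic_pred_nth_smallest[OF fin j(1)] S by simp
  next
    case False
    then show ?thesis
      unfolding next_guess_def Let_def assms(1)[symmetric] by simp
  qed
qed

lemma nth_smallest_atLeastAtMost: "j \<in> {1..n} \<Longrightarrow> nth_smallest {1..n} j = j"
  by (auto simp: nth_smallest_def atLeastLessThanSuc_atLeastAtMost[symmetric]
      simp del: upt_Suc)

text \<open>All \<open>n\<close> entries move by \<open>CSL n n\<close>, which sends each position
  to its cyclic predecessor; hence position \<open>i\<close> receives the entry of its cyclic
  successor.\<close>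

lemma guess_2:
  assumes "correct_at n (CSL n) \<pi> 1 = {}"
  shows "guess n (CSL n) \<pi> 2 = CS n"
proof
  fix i
  have corr: "correct_positions n \<pi> id = {}"
    using assms by (simp add: correct_at_def guess_1)
  have g2: "guess n (CSL n) \<pi> 2 = next_guess n (CSL n) \<pi> id"
    using guess_Suc[of 1] by (simp add: guess_1 numeral_2_eq_2)
  show "guess n (CSL n) \<pi> 2 i = CS n i"
  proof (cases "i \<in> {1..n}")
    case True
    then have j: "CS n i \<in> {1..n}" and inv: "CSL n n (CS n i) = i"
      by (auto simp: CS_def CSL_def)
    show ?thesis
      using next_guess_incorrect[OF is_strategy_CSL, of "{1..n}" n \<pi> id "CS n i"] corr j inv True
        nth_smallest_atLeastAtMost[OF j] nth_smallest_atLeastAtMost[OF True] g2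
      by simp
  next
    case False
    then show ?thesis by (auto simp: g2 next_guess_def Let_def CS_def)
  qed
qed

text \<open>A correct position in the second guess leaves fewer than \<open>n\<close> wrong ones, so
  this move is an ordinary cyclic shift, opposite in direction to the previous one.\<close>

lemma guess_3:
  assumes "correct_at n (CSL n) \<pi> 1 = {}" "correct_at n (CSL n) \<pi> 2 \<noteq> {}"
    and I: "I = {1..n} - correct_at n (CSL n) \<pi> 2"
  shows "guess n (CSL n) \<pi> 3 = (\<lambda>i. if i \<in> I then CS n (cyclic_pred I i) else CS n i)"
proof -
  have "correct_at n (CSL n) \<pi> 2 \<subseteq> {1..n}"
    unfolding correct_at_def correct_positions_def by blast
  then have "I \<subset> {1..n}"
    using assms(2) I by blast
  then have "card I < n"
    using psubset_card_mono[of "{1..n}" I] by simp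
  then show ?thesis
    using guess_Suc[of 2 n "CSL n" \<pi>] next_guess_CS[of I n \<pi> "CS n"]
      I[unfolded correct_at_def guess_2[OF assms(1)]]
    by (simp only: guess_2[OF assms(1)]) (simp add: numeral_3_eq_3 numeral_2_eq_2)
qed

text \<open>The witness \<open>r\<close> ensures that the \<open>LEAST\<close> in \<open>rho\<close>
  is attained.\<close>

lemma rho_eq_2_iff:
  assumes "correct_at n S \<pi> r \<noteq> {}" "1 \<le> r"
  shows "rho n S \<pi> = 2 \<longleftrightarrow> correct_at n S \<pi> 1 = {} \<and> correct_at n S \<pi> 2 \<noteq> {}"
proof
  assume *: "rho n S \<pi> = 2"
  have "1 \<le> rho n S \<pi> \<and> correct_at n S \<pi> (rho n S \<pi>) \<noteq> {}"
    unfolding rho_def by (rule LeastI[of _ r]) (use assms in simp)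
  moreover have "\<not> (1 \<le> (1::nat) \<and> correct_at n S \<pi> 1 \<noteq> {})"
    by (rule not_less_Least) (use * in \<open>simp add: rho_def\<close>)
  ultimately show "correct_at n S \<pi> 1 = {} \<and> correct_at n S \<pi> 2 \<noteq> {}"
    using * by simp
next
  assume *: "correct_at n S \<pi> 1 = {} \<and> correct_at n S \<pi> 2 \<noteq> {}"
  show "rho n S \<pi> = 2"
    unfolding rho_def
  proof (rule Least_equality)
    show "2 \<le> y" if "1 \<le> y \<and> correct_at n S \<pi> y \<noteq> {}" for y
      using that * by (cases "y = 1") auto
  qed (use * in simp)
qed

lemma game_ends_after_3_iff:
  "game_ends_after n S \<pi> 3 \<longleftrightarrow> correct_at n S \<pi> 3 = {1..n} \<and>
    correct_at n S \<pi> 1 \<noteq> {1..n} \<and> correct_at n S \<pi> 2 \<noteq> {1..n}"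
proof -
  have "1 \<le> r \<and> r < 3 \<longleftrightarrow> r = 1 \<or> r = 2" for r :: nat by auto
  then show ?thesis by (auto simp: game_ends_after_def simp del: One_nat_def)
qed

section \<open>Secrets and independent sets\<close>

text \<open>The formula of the third guess, detached from any game so that it can serve as the
  inverse of \<open>wrong_positions\<close>.\<close>

definition secret_of :: "nat \<Rightarrow> nat set \<Rightarrow> nat \<Rightarrow> nat" where
  "secret_of n I = (\<lambda>i. if i \<in> I then CS n (cyclic_pred I i) else CS n i)"

definition wrong_positions :: "nat \<Rightarrow> (nat \<Rightarrow> nat) \<Rightarrow> nat set" where
  "wrong_positions n \<pi> = {i \<in> {1..n}. CS n i \<noteq> \<pi> i}"

text \<open>The secret is \<open>CS n\<close> composed with the permutation that rotates
  \<open>I\<close> and fixes everything else.\<close>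

lemma secret_of_permutes:
  assumes "I \<subseteq> {1..n}"
  shows "secret_of n I permutes {1..n}"
proof -
  have "(\<lambda>i. if i \<in> I then cyclic_pred I i else i) permutes I"
    using bij_betw_cyclic_pred[of I] finite_subset[OF assms]
    by (intro bij_imp_permutes) (auto cong: bij_betw_cong)
  then have "(\<lambda>i. if i \<in> I then cyclic_pred I i else i) permutes {1..n}"
    using assms by (rule permutes_subset)
  then have "CS n \<circ> (\<lambda>i. if i \<in> I then cyclic_pred I i else i) permutes {1..n}"
    by (rule permutes_compose[OF _ CS_permutes])
  then show ?thesis
    by (simp add: secret_of_def comp_def if_distrib cong: if_cong)
qed

lemma wrong_positions_secret_of:
  assumes "I \<subseteq> {1..n}" "2 \<le> card I"
  shows "wrong_positions n (secret_of n I) = I"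
proof -
  have "finite I" using assms(1) finite_subset by blast
  then have "CS n i \<noteq> CS n (cyclic_pred I i)" if "i \<in> I" for i
    using cyclic_pred_neq_self[OF _ assms(2) that] injD[OF inj_CS] by metis
  then show ?thesis
    using assms(1) by (auto simp: wrong_positions_def secret_of_def)
qed

text \<open>Since \<open>CS n\<close> has no fixed point on \<open>{1..n}\<close>, a fixed point
  \<open>i\<close> lies in \<open>I\<close> and satisfies \<open>CS n p = i\<close> for its
  predecessor \<open>p\<close> in \<open>I\<close>, an adjacent pair. Conversely, if
  \<open>i\<close> and \<open>CS n i\<close> are both in \<open>I\<close>, then
  \<open>CS n i\<close> is fixed.\<close>

lemma secret_of_no_fixpoint_iff:
  assumes "2 \<le> n" "I \<subseteq> {1..n}"
  shows "(\<forall>i\<in>{1..n}. secret_of n I i \<noteq> i) \<longleftrightarrow> I \<in> cycle_indep n"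
proof
  assume *: "\<forall>i\<in>{1..n}. secret_of n I i \<noteq> i"
  have "CS n i \<notin> I" if "i \<in> I" for i
    using * cyclic_pred_CS[OF assms(2) that] CS_in_range[of i n] that assms(2)
    by (fastforce simp: secret_of_def)
  then show "I \<in> cycle_indep n" using assms(2) by (simp add: cycle_indep_def)
next
  assume *: "I \<in> cycle_indep n"
  have fin: "finite I" using assms(2) finite_subset by blast
  show "\<forall>i\<in>{1..n}. secret_of n I i \<noteq> i"
  proof
    fix i assume "i \<in> {1..n}"
    then show "secret_of n I i \<noteq> i"
      using * cyclic_pred_in[OF fin, of i] CS_neq_self[OF assms(1), of i]
      unfolding secret_of_def cycle_indep_def by (metis (mono_tags, lifting) mem_Collect_eq)
  qed
qed

text \<open>The four conditions say in turn: the first guess has nothing right, the second is not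
  the secret, the second has something right, and the third is the secret.\<close>

lemma three_guess_secret_iff:
  assumes "2 \<le> n" "\<pi> permutes {1..n}"
  shows "game_ends_after n (CSL n) \<pi> 3 \<and> rho n (CSL n) \<pi> = 2 \<longleftrightarrow>
    (\<forall>i\<in>{1..n}. \<pi> i \<noteq> i) \<and> wrong_positions n \<pi> \<noteq> {} \<and> wrong_positions n \<pi> \<noteq> {1..n} \<and>
    secret_of n (wrong_positions n \<pi>) = \<pi>"
    (is "?L \<longleftrightarrow> ?R")
proof -
  let ?C = "correct_at n (CSL n) \<pi>" and ?I = "wrong_positions n \<pi>"
  have ne: "{1..n} \<noteq> {}" using assms(1) by auto
  have C1: "?C 1 = {} \<longleftrightarrow> (\<forall>i\<in>{1..n}. \<pi> i \<noteq> i)"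
    unfolding correct_at_def correct_positions_def One_nat_def guess_1 id_apply
    by (metis (mono_tags, lifting) Collect_empty_eq)
  have "?L \<longleftrightarrow> ?C 1 = {} \<and> ?C 2 \<noteq> {} \<and> ?C 2 \<noteq> {1..n} \<and> ?C 3 = {1..n}"
    using rho_eq_2_iff[of n "CSL n" \<pi> 3] ne by (auto simp: game_ends_after_3_iff)
  also have "\<dots> \<longleftrightarrow> ?R"
  proof (cases "?C 1 = {}")
    case True
    have C2: "?C 2 = {1..n} - ?I"
      by (auto simp: correct_at_def correct_positions_def guess_2[OF True] wrong_positions_def)
    have sub: "?I \<subseteq> {1..n}" by (auto simp: wrong_positions_def)
    have C3: "?C 3 = {1..n} \<longleftrightarrow> secret_of n ?I = \<pi>" if "?C 2 \<noteq> {}"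
    proof -
      have I: "?I = {1..n} - ?C 2" using sub by (auto simp: C2)
      have g3: "guess n (CSL n) \<pi> 3 = secret_of n ?I"
        using guess_3[OF True that I] by (simp add: secret_of_def)
      \<comment> \<open>Both permutations are the identity outside \<open>{1..n}\<close>, so
        agreement on all positions is equality of functions.\<close>
      have "secret_of n ?I i = \<pi> i" if "i \<notin> {1..n}" for i
        using permutes_not_in[OF secret_of_permutes[OF sub] that] permutes_not_in[OF assms(2) that]
        by simp
      then have "secret_of n ?I = \<pi> \<longleftrightarrow> (\<forall>i\<in>{1..n}. secret_of n ?I i = \<pi> i)"
        by (auto simp: fun_eq_iff simp del: atLeastAtMost_iff)
      then show ?thesis
        by (auto simp: correct_at_def correct_positions_def g3)
    qed
    show ?thesis using True C1 C2 C3 sub by auto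
  next
    case False
    then show ?thesis using C1 by simp
  qed
  finally show ?thesis .
qed

lemma bij_betw_wrong_positions:
  assumes "2 \<le> n"
  shows "bij_betw (wrong_positions n)
    {\<pi>. \<pi> permutes {1..n} \<and> game_ends_after n (CSL n) \<pi> 3 \<and> rho n (CSL n) \<pi> = 2}
    {I \<in> cycle_indep n. 2 \<le> card I}"
    (is "bij_betw _ ?P ?Q")
proof (rule bij_betw_byWitness[where f' = "secret_of n"])
  show "\<forall>\<pi>\<in>?P. secret_of n (wrong_positions n \<pi>) = \<pi>"
    using three_guess_secret_iff[OF assms] by blast
  show "\<forall>I\<in>?Q. wrong_positions n (secret_of n I) = I"
    using wrong_positions_secret_of by (simp add: cycle_indep_def)
  show "wrong_positions n ` ?P \<subseteq> ?Q"
  proof safe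
    fix \<pi> assume \<pi>: "\<pi> permutes {1..n}" "game_ends_after n (CSL n) \<pi> 3" "rho n (CSL n) \<pi> = 2"
    let ?I = "wrong_positions n \<pi>"
    have *: "\<forall>i\<in>{1..n}. \<pi> i \<noteq> i" "?I \<noteq> {}" "secret_of n ?I = \<pi>"
      using three_guess_secret_iff[OF assms \<pi>(1)] \<pi> by auto
    have sub: "?I \<subseteq> {1..n}" by (auto simp: wrong_positions_def)
    then have fin: "finite ?I" using finite_subset by blast
    show "?I \<in> cycle_indep n"
      using secret_of_no_fixpoint_iff[OF assms sub] * by simp
    show "2 \<le> card ?I"
    proof (rule ccontr)
      assume "\<not> 2 \<le> card ?I"
      then have "card ?I = 1" using *(2) fin card_0_eq[OF fin] by linarith
      then obtain i where i: "?I = {i}" by (auto simp: card_1_singleton_iff)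
      \<comment> \<open>A single element is its own cyclic predecessor, so the secret would already
        be the second guess and no position would be wrong.\<close>
      then have "secret_of n ?I = CS n"
        using cyclic_pred_in[OF fin, of i] by (auto simp: secret_of_def)
      then show False using *(2,3) by (simp add: wrong_positions_def)
    qed
  qed
  show "secret_of n ` ?Q \<subseteq> ?P"
  proof (rule image_subsetI)
    fix I assume I: "I \<in> ?Q"
    then have sub: "I \<subseteq> {1..n}" and wrong: "wrong_positions n (secret_of n I) = I"
      using wrong_positions_secret_of by (auto simp: cycle_indep_def)
    obtain i where i: "i \<in> I" using I by fastforce
    \<comment> \<open>Independence supplies a position outside \<open>I\<close>, that is, a correct
      one in the second guess.\<close>
    then have "CS n i \<in> {1..n} - I"
      using I sub CS_in_range[of i n] by (auto simp: cycle_indep_def)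
    then have "I \<noteq> {1..n}" by auto
    then show "secret_of n I \<in> ?P"
      using three_guess_secret_iff[OF assms secret_of_permutes[OF sub]] wrong i I
        secret_of_no_fixpoint_iff[OF assms sub] secret_of_permutes[OF sub] by auto
  qed
qed

theorem theorem4p10:
  fixes n :: nat
  assumes "n \<ge> 4"
  shows "int (card {\<pi>. \<pi> permutes {1..n} \<and> game_ends_after n (CSL n) \<pi> 3 \<and> rho n (CSL n) \<pi> = 2})
         = int (lucas n) - int n - 1"
proof -
  have "2 \<le> n" using assms by simp
  from bij_betw_same_card[OF bij_betw_wrong_positions[OF this]] show ?thesis
    using card_cycle_indep_ge_2[of n] assms by linarith
qed

end
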